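(* Let $0<\alpha<1$, $x>0$ and $y\in C^\infty[0,x]$. For integers $n\ge 2$ put $h=x/n$, $y_j=y(jh)$ for $0\le j\le n$, and define $$\omega_0^{(\alpha)}=-\zeta(1+\alpha),\qquad \omega_k^{(\alpha)}=\frac{1}{k^{1+\alpha}}\quad(1\le k\le n-1),\qquad \omega_n^{(\alpha)}=\zeta(1+\alpha)-\sum_{k=1}^{n-1}\frac{1}{k^{1+\alpha}}.$$ Then, as $n\to\infty$ with $x$ fixed, $$\frac{1}{\Gamma(-\alpha)h^\alpha}\sum_{k=0}^{n}\omega_k^{(\alpha)}y_{n-k}=y^{(\alpha)}(x)+O\left(h^{1-\alpha}\right).$$
   Context: $\zeta$ is the Riemann zeta function. For $0<\alpha<1$ the Caputo derivative is $y^{(\alpha)}(x)=\frac{1}{\Gamma(1-\alpha)}\int_0^x\frac{y'(t)}{(x-t)^\alpha}\,dt$. The constant implied by $O(\cdot)$ may depend on $y,\alpha,x$ but not on $n$. *)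

theory Defs
  imports "HOL-Analysis.Analysis" "HOL-Library.Landau_Symbols"
begin

(* The Riemann zeta function on the real half-line s > 1, given by its Dirichlet series
   \<Sum>k\<ge>1. k^(-s); no meaning is attached to the values for s \<le> 1. *)
definition zeta :: "real \<Rightarrow> real" where
  "zeta s = (\<Sum>k. 1 / real (Suc k) powr s)"

(* f is infinitely differentiable on S. The derivatives are taken within S, so that on a closed
   interval they are one-sided at the endpoints; values of f outside S are irrelevant.
   D k is the k-th derivative. *)
definition smooth_on_set :: "real set \<Rightarrow> (real \<Rightarrow> real) \<Rightarrow> bool" where
  "smooth_on_set S f \<longleftrightarrow>
     (\<exists>D :: nat \<Rightarrow> real \<Rightarrow> real.
        (\<forall>t\<in>S. D 0 t = f t) \<and>
        (\<forall>k. \<forall>t\<in>S. (D k has_real_derivative D (Suc k) t) (at t within S)))"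

(* For differentiable y, the vector derivative within {0..x} is y', one-sided at the endpoints.
   The integrand is singular at t = x, where it evaluates to 0 by the convention on division. *)
definition caputo :: "real \<Rightarrow> (real \<Rightarrow> real) \<Rightarrow> real \<Rightarrow> real" where
  "caputo \<alpha> y x =
     1 / Gamma (1 - \<alpha>) *
     integral {0..x} (\<lambda>t. vector_derivative y (at t within {0..x}) / (x - t) powr \<alpha>)"

definition weight :: "real \<Rightarrow> nat \<Rightarrow> nat \<Rightarrow> real" where
  "weight \<alpha> n k =
     (if k = 0 then - zeta (1 + \<alpha>)
      else if k < n then 1 / real k powr (1 + \<alpha>)
      else zeta (1 + \<alpha>) - (\<Sum>j = 1..n - 1. 1 / real j powr (1 + \<alpha>)))"

end

theory Submission
  imports Defs
begin

text \<open>
  The weights \<open>\<omega>\<close> sum to zero, and the negatives of their partial sums are the zeta tails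
  \<open>\<tau> k = (\<Sum>j>k. 1 / j powr (1 + \<alpha>))\<close>. Summation by parts (\<open>sum_weight_by_parts\<close>) therefore turns
  the weighted sum of values of \<open>y\<close> into a sum of increments of \<open>y\<close>, that is, of integrals of
  \<open>y'\<close>, over the blocks \<open>{x - (k + 1) h..x - k h}\<close>. Since \<open>Gamma (1 - \<alpha>) = - \<alpha> Gamma (- \<alpha>)\<close>,
  the discrete operator becomes the Caputo integral in which the kernel
  \<open>(x - t) powr - \<alpha>\<close> has been replaced on the \<open>k\<close>-th block by the constant
  \<open>h powr - \<alpha> * \<alpha> * \<tau> k\<close>.

  With \<open>u = (x - t) / h\<close>, which lies in \<open>{k..k + 1}\<close> on that block, the kernel is
  \<open>h powr - \<alpha> * u powr - \<alpha>\<close>. For \<open>k > 0\<close>, comparing the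
  zeta series with a telescoping series of values of \<open>u powr - \<alpha>\<close> puts \<open>\<alpha> * \<tau> k\<close> between \<open>(k + 1) powr - \<alpha>\<close> and
  \<open>k powr - \<alpha>\<close> (\<open>zeta_tail_lower\<close>, \<open>zeta_tail_upper\<close>), the same bounds as for \<open>u powr - \<alpha>\<close>.
  So the block contributes an error of at most
  \<open>M h powr (1 - \<alpha>) (k powr - \<alpha> - (k + 1) powr - \<alpha>)\<close>, where \<open>M\<close> bounds \<open>\<bar>y'\<bar>\<close>
  (\<open>block_error_regular\<close>). These errors telescope, to at most \<open>M h powr (1 - \<alpha>)\<close>. On the block
  \<open>k = 0\<close>, next to the singularity, both kernels have integrals of order \<open>h powr (1 - \<alpha>)\<close>
  (\<open>block_error_singular\<close>), so that no cancellation has to be exploited there.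
\<close>

section \<open>Tails of the zeta series\<close>

text \<open>
  This is the Hurwitz zeta value \<open>(\<Sum>j>k. 1 / j powr (1 + \<alpha>))\<close>, see \<open>zeta_tail_sums\<close>. The
  difference form is the one in which it occurs in the last weight.
\<close>
definition zeta_tail :: "real \<Rightarrow> nat \<Rightarrow> real" where
  "zeta_tail \<alpha> k = zeta (1 + \<alpha>) - (\<Sum>j = 1..k. 1 / real j powr (1 + \<alpha>))"

lemma zeta_tail_0 [simp]: "zeta_tail \<alpha> 0 = zeta (1 + \<alpha>)"
  by (simp add: zeta_tail_def)

lemma zeta_tail_Suc: "zeta_tail \<alpha> (Suc k) = zeta_tail \<alpha> k - 1 / real (Suc k) powr (1 + \<alpha>)"
  by (simp add: zeta_tail_def)

lemma zeta_tail_sums: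
  assumes "0 < \<alpha>"
  shows "(\<lambda>j. 1 / real (Suc (j + k)) powr (1 + \<alpha>)) sums zeta_tail \<alpha> k"
proof -
  let ?f = "\<lambda>j. 1 / real (Suc j) powr (1 + \<alpha>)"
  have "summable (\<lambda>j. real j powr (- 1 - \<alpha>))"
    using assms by (simp add: summable_real_powr_iff)
  then have "summable (\<lambda>j. real (Suc j) powr (- 1 - \<alpha>))"
    by (subst summable_Suc_iff)
  also have "(\<lambda>j. real (Suc j) powr (- 1 - \<alpha>)) = ?f"
    by (simp add: powr_minus_divide[symmetric] del: of_nat_Suc)
  finally have "?f sums zeta (1 + \<alpha>)"
    by (simp add: zeta_def summable_sums)
  then have "(\<lambda>j. ?f (j + k)) sums (zeta (1 + \<alpha>) - (\<Sum>j<k. ?f j))"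
    by (rule sums_split_initial_segment)
  moreover have "(\<Sum>j<k. ?f j) = (\<Sum>j = 1..k. 1 / real j powr (1 + \<alpha>))"
    by (rule sum.reindex_bij_witness[of _ "\<lambda>j. j - 1" Suc]) auto
  ultimately show ?thesis
    by (simp add: zeta_tail_def)
qed

text \<open>
  By the mean value theorem, the difference is \<open>\<alpha> * (b - a) / z powr (1 + \<alpha>)\<close> for some \<open>z\<close>
  between \<open>a\<close> and \<open>b\<close>. With \<open>b = a + 1\<close> this compares the terms of the zeta series with
  those of a telescoping series.
\<close>
lemma powr_neg_diff_bounds:
  fixes a b \<alpha> :: real
  assumes "0 < a" "a < b" "0 < \<alpha>"
  shows "\<alpha> * (b - a) / b powr (1 + \<alpha>) \<le> a powr - \<alpha> - b powr - \<alpha>"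
    and "a powr - \<alpha> - b powr - \<alpha> \<le> \<alpha> * (b - a) / a powr (1 + \<alpha>)"
proof -
  have "((\<lambda>u. u powr - \<alpha>) has_real_derivative - \<alpha> * u powr (- \<alpha> - 1)) (at u)" if "a \<le> u" for u
    using that assms has_real_derivative_powr[of u "- \<alpha>"] by simp
  then obtain z where z: "a < z" "z < b"
      "b powr - \<alpha> - a powr - \<alpha> = (b - a) * (- \<alpha> * z powr (- \<alpha> - 1))"
    using MVT2[OF \<open>a < b\<close>, of "\<lambda>u. u powr - \<alpha>" "\<lambda>u. - \<alpha> * u powr (- \<alpha> - 1)"] by blast
  have "- \<alpha> - 1 = - (1 + \<alpha>)"
    by simp
  then have "z powr (- \<alpha> - 1) = 1 / z powr (1 + \<alpha>)"
    by (simp only: powr_minus_divide)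
  with z have eq: "a powr - \<alpha> - b powr - \<alpha> = \<alpha> * (b - a) / z powr (1 + \<alpha>)"
    by (simp add: algebra_simps)
  have "0 < a powr (1 + \<alpha>)" "a powr (1 + \<alpha>) \<le> z powr (1 + \<alpha>)" "z powr (1 + \<alpha>) \<le> b powr (1 + \<alpha>)"
    using z assms by (auto intro!: powr_mono2)
  then show "\<alpha> * (b - a) / b powr (1 + \<alpha>) \<le> a powr - \<alpha> - b powr - \<alpha>"
    and "a powr - \<alpha> - b powr - \<alpha> \<le> \<alpha> * (b - a) / a powr (1 + \<alpha>)"
    unfolding eq using assms by (auto intro!: divide_left_mono mult_pos_pos)
qed

lemma powr_neg_telescope_sums:
  fixes \<alpha> :: real
  assumes "0 < \<alpha>"
  shows "(\<lambda>j. real (j + m) powr - \<alpha> - real (Suc (j + m)) powr - \<alpha>) sums real m powr - \<alpha>"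
proof -
  have "filterlim (\<lambda>j. real (j + m)) at_top sequentially"
    by (intro filterlim_compose[OF filterlim_real_sequentially] filterlim_add_const_nat_at_top)
  then have "(\<lambda>j. real (j + m) powr - \<alpha>) \<longlonglongrightarrow> 0"
    using assms by (intro tendsto_neg_powr) auto
  from telescope_sums'[OF this] show ?thesis
    by simp
qed

lemma zeta_tail_lower:
  assumes "0 < \<alpha>"
  shows "real (Suc k) powr - \<alpha> \<le> \<alpha> * zeta_tail \<alpha> k"
proof (rule sums_le)
  show "(\<lambda>j. real (j + Suc k) powr - \<alpha> - real (Suc (j + Suc k)) powr - \<alpha>) sums real (Suc k) powr - \<alpha>"
    by (rule powr_neg_telescope_sums[OF assms])
  show "(\<lambda>j. \<alpha> * (1 / real (Suc (j + k)) powr (1 + \<alpha>))) sums (\<alpha> * zeta_tail \<alpha> k)"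
    by (intro sums_mult zeta_tail_sums assms)
  show "real (j + Suc k) powr - \<alpha> - real (Suc (j + Suc k)) powr - \<alpha>
      \<le> \<alpha> * (1 / real (Suc (j + k)) powr (1 + \<alpha>))" for j
    using powr_neg_diff_bounds(2)[of "real (j + Suc k)" "real (Suc (j + Suc k))" \<alpha>] assms by simp
qed

lemma zeta_tail_upper:
  assumes "0 < \<alpha>" and "0 < k"
  shows "\<alpha> * zeta_tail \<alpha> k \<le> real k powr - \<alpha>"
proof (rule sums_le)
  show "(\<lambda>j. real (j + k) powr - \<alpha> - real (Suc (j + k)) powr - \<alpha>) sums real k powr - \<alpha>"
    by (rule powr_neg_telescope_sums[OF assms(1)])
  show "(\<lambda>j. \<alpha> * (1 / real (Suc (j + k)) powr (1 + \<alpha>))) sums (\<alpha> * zeta_tail \<alpha> k)"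
    by (intro sums_mult zeta_tail_sums assms)
  show "\<alpha> * (1 / real (Suc (j + k)) powr (1 + \<alpha>))
      \<le> real (j + k) powr - \<alpha> - real (Suc (j + k)) powr - \<alpha>" for j
    using powr_neg_diff_bounds(1)[of "real (j + k)" "real (Suc (j + k))" \<alpha>] assms by simp
qed

section \<open>Summation by parts\<close>

text \<open>
  The weight at \<open>0\<close> is \<open>- zeta_tail \<alpha> 0\<close>, an inner weight is a difference of successive tails, and
  the last weight is the tail that remains, which makes all boundary terms cancel.
\<close>
lemma sum_weight_by_parts:
  assumes "0 < n"
  shows "(\<Sum>k = 0..n. weight \<alpha> n k * f k) = (\<Sum>k<n. zeta_tail \<alpha> k * (f (Suc k) - f k))"
proof -
  let ?v = "\<lambda>k. if k = 0 then - zeta (1 + \<alpha>) else 1 / real k powr (1 + \<alpha>)"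
  \<comment> \<open>The weights depend on \<open>n\<close> only through the last one, so the induction runs over the
    weights \<open>?v\<close>, which do not depend on \<open>n\<close>, and carries the last term separately.\<close>
  have parts: "(\<Sum>k<m. zeta_tail \<alpha> k * (f (Suc k) - f k))
      = (\<Sum>k<m. ?v k * f k) + zeta_tail \<alpha> (m - 1) * f m" if "0 < m" for m
    using that
  proof (induction m)
    case (Suc m)
    show ?case
    proof (cases "m = 0")
      case False
      then obtain l where "m = Suc l"
        using not0_implies_Suc by blast
      with Suc show ?thesis
        by (simp add: zeta_tail_Suc algebra_simps)
    qed (simp add: algebra_simps)
  qed simp
  have "(\<Sum>k = 0..n. weight \<alpha> n k * f k) = (\<Sum>k<n. weight \<alpha> n k * f k) + weight \<alpha> n n * f n"
    using sum.lessThan_Suc[of "\<lambda>k. weight \<alpha> n k * f k" n] by (simp add: atLeast0AtMost lessThan_Suc_atMost)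
  also have "(\<Sum>k<n. weight \<alpha> n k * f k) = (\<Sum>k<n. ?v k * f k)"
    by (intro sum.cong) (auto simp: weight_def)
  also have "weight \<alpha> n n = zeta_tail \<alpha> (n - 1)"
    using assms by (simp add: weight_def zeta_tail_def)
  finally show ?thesis
    using parts[OF assms] by simp
qed

section \<open>The quadrature error\<close>

text \<open>
  The antiderivative is continuous up to \<open>t = x\<close>, although it is not differentiable there, because
  \<open>1 - \<alpha> > 0\<close>.
\<close>
lemma has_integral_caputo_kernel:
  fixes \<alpha> x h :: real
  assumes "0 < \<alpha>" "\<alpha> < 1" "0 \<le> h"
  shows "((\<lambda>t. 1 / (x - t) powr \<alpha>) has_integral h powr (1 - \<alpha>) / (1 - \<alpha>)) {x - h..x}"
proof -
  let ?F = "\<lambda>t. - ((x - t) powr (1 - \<alpha>) / (1 - \<alpha>))"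
  have "((\<lambda>t. 1 / (x - t) powr \<alpha>) has_integral ?F x - ?F (x - h)) {x - h..x}"
  proof (rule fundamental_theorem_of_calculus_interior)
    show "continuous_on {x - h..x} ?F"
      using assms
      by (intro continuous_on_minus continuous_on_divide continuous_on_powr' continuous_on_diff
                continuous_on_id continuous_on_const) auto
    show "(?F has_vector_derivative 1 / (x - t) powr \<alpha>) (at t)" if "t \<in> {x - h<..<x}" for t
      unfolding has_real_derivative_iff_has_vector_derivative[symmetric]
      using that assms
      by (auto intro!: derivative_eq_intros simp: powr_minus_divide)
  qed (use assms in auto)
  then show ?thesis
    using assms by simp
qed

lemma caputo_integrand_absolutely_integrable:
  fixes g :: "real \<Rightarrow> real"
  assumes "0 < \<alpha>" "\<alpha> < 1" "0 \<le> x" and g: "continuous_on {0..x} g"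
  shows "(\<lambda>t. g t / (x - t) powr \<alpha>) absolutely_integrable_on {0..x}"
proof -
  have "(\<lambda>t. 1 / (x - t) powr \<alpha>) absolutely_integrable_on {0..x}"
    using has_integral_caputo_kernel[of \<alpha> x x] assms
    by (intro nonnegative_absolutely_integrable_1) auto
  then have "(\<lambda>t. g t * (1 / (x - t) powr \<alpha>)) absolutely_integrable_on {0..x}"
    using g
    by (intro absolutely_integrable_bounded_measurable_product_real
              continuous_imp_measurable_on_sets_lebesgue compact_imp_bounded
              compact_continuous_image) auto
  then show ?thesis
    by simp
qed

lemma sum_integral_backward_blocks:
  fixes f :: "real \<Rightarrow> real"
  assumes "0 \<le> h" and "f integrable_on {x - real n * h..x}"
  shows "(\<Sum>k<n. integral {x - real (Suc k) * h..x - real k * h} f) = integral {x - real n * h..x} f"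
  using assms(2)
proof (induction n)
  case (Suc n)
  have le: "x - real (Suc n) * h \<le> x - real n * h" "x - real n * h \<le> x"
    using assms(1) by (auto simp: algebra_simps)
  have "f integrable_on {x - real n * h..x}"
    by (rule integrable_subinterval_real[OF Suc.prems]) (use le in auto)
  with Suc.IH Henstock_Kurzweil_Integration.integral_combine[OF le Suc.prems] show ?case
    by simp
qed simp

text \<open>
  After rescaling by \<open>h\<close>, both the true kernel and its constant replacement lie between
  \<open>real (Suc k) powr - \<alpha>\<close> and \<open>real k powr - \<alpha>\<close>, so they differ by at most the length of this
  interval.
\<close>
lemma block_error_regular:
  fixes g :: "real \<Rightarrow> real"
  assumes "0 < \<alpha>" "0 < h" "0 < k"
    and g: "continuous_on {x - real (Suc k) * h..x - real k * h} g"
    and M: "\<And>t. t \<in> {x - real (Suc k) * h..x - real k * h} \<Longrightarrow> \<bar>g t\<bar> \<le> M"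
  shows "\<bar>integral {x - real (Suc k) * h..x - real k * h}
            (\<lambda>t. g t * (\<alpha> * zeta_tail \<alpha> k / h powr \<alpha> - 1 / (x - t) powr \<alpha>))\<bar>
         \<le> M * h powr (1 - \<alpha>) * (real k powr - \<alpha> - real (Suc k) powr - \<alpha>)"
proof -
  let ?a = "x - real (Suc k) * h" and ?b = "x - real k * h"
  let ?c = "\<alpha> * zeta_tail \<alpha> k / h powr \<alpha>"
  let ?B = "M * ((real k powr - \<alpha> - real (Suc k) powr - \<alpha>) / h powr \<alpha>)"
  have ab: "?a \<le> ?b" and kh: "0 < real k * h"
    using assms by (auto simp: algebra_simps)
  have "norm (integral {?a..?b} (\<lambda>t. g t * (?c - 1 / (x - t) powr \<alpha>))) \<le> ?B * (?b - ?a)"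
  proof (rule integral_bound[OF ab])
    show "continuous_on {?a..?b} (\<lambda>t. g t * (?c - 1 / (x - t) powr \<alpha>))"
    proof (intro continuous_intros g ballI)
      fix t assume "t \<in> {?a..?b}"
      with kh have "0 < x - t"
        by simp
      then show "x - t \<noteq> 0" "(x - t) powr \<alpha> \<noteq> 0"
        by simp_all
    qed
    show "norm (g t * (?c - 1 / (x - t) powr \<alpha>)) \<le> ?B" if t: "t \<in> {?a..?b}" for t
    proof -
      define u where "u = (x - t) / h"
      have xt: "0 < x - t"
        using t kh by simp
      have u: "real k \<le> u" "u \<le> real (Suc k)" "0 < u"
        using t assms(2) xt by (simp_all add: u_def pos_le_divide_eq pos_divide_le_eq)
      have "1 / (x - t) powr \<alpha> = u powr - \<alpha> / h powr \<alpha>"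
        using xt assms(2) by (simp add: u_def powr_divide powr_minus_divide)
      moreover have "real (Suc k) powr - \<alpha> \<le> u powr - \<alpha>" "u powr - \<alpha> \<le> real k powr - \<alpha>"
        using u assms by (auto intro!: powr_mono2')
      then have "\<bar>\<alpha> * zeta_tail \<alpha> k - u powr - \<alpha>\<bar> \<le> real k powr - \<alpha> - real (Suc k) powr - \<alpha>"
        using zeta_tail_lower[OF \<open>0 < \<alpha>\<close>, of k] zeta_tail_upper[OF \<open>0 < \<alpha>\<close> \<open>0 < k\<close>] by linarith
      ultimately have "\<bar>?c - 1 / (x - t) powr \<alpha>\<bar> \<le> (real k powr - \<alpha> - real (Suc k) powr - \<alpha>) / h powr \<alpha>"
        using assms by (simp add: diff_divide_distrib[symmetric] divide_right_mono)
      with M[OF t] show ?thesis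
        unfolding real_norm_def abs_mult by (intro mult_mono') auto
    qed
  qed
  moreover have "?b - ?a = h"
    by (simp add: algebra_simps)
  then have "?B * (?b - ?a) = M * h powr (1 - \<alpha>) * (real k powr - \<alpha> - real (Suc k) powr - \<alpha>)"
    using \<open>0 < h\<close> by (simp add: powr_diff)
  ultimately show ?thesis
    by simp
qed

text \<open>
  Here the kernel is unbounded, but integrable, and the sum of the integrals of both kernels already
  has the right order.
\<close>
lemma block_error_singular:
  fixes g :: "real \<Rightarrow> real"
  assumes "0 < \<alpha>" "\<alpha> < 1" "0 < h"
    and int: "(\<lambda>t. g t / (x - t) powr \<alpha>) integrable_on {x - h..x}"
    and g: "continuous_on {x - h..x} g"
    and M: "\<And>t. t \<in> {x - h..x} \<Longrightarrow> \<bar>g t\<bar> \<le> M"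
  shows "\<bar>integral {x - h..x} (\<lambda>t. g t * (\<alpha> * zeta (1 + \<alpha>) / h powr \<alpha> - 1 / (x - t) powr \<alpha>))\<bar>
         \<le> M * h powr (1 - \<alpha>) * (\<alpha> * zeta (1 + \<alpha>) + 1 / (1 - \<alpha>))"
proof -
  let ?c = "\<alpha> * zeta (1 + \<alpha>) / h powr \<alpha>"
  have c: "0 \<le> ?c"
    using zeta_tail_lower[OF \<open>0 < \<alpha>\<close>, of 0] by simp
  have "((\<lambda>t. M * (?c + 1 / (x - t) powr \<alpha>)) has_integral
      M * (?c * h + h powr (1 - \<alpha>) / (1 - \<alpha>))) {x - h..x}"
    using has_integral_const_real[of ?c "x - h" x] has_integral_caputo_kernel[of \<alpha> h x] assms
    by (intro has_integral_mult_right has_integral_add) (auto simp: mult.commute)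
  then have majorant: "(\<lambda>t. M * (?c + 1 / (x - t) powr \<alpha>)) integrable_on {x - h..x}"
      and majorant_eq: "integral {x - h..x} (\<lambda>t. M * (?c + 1 / (x - t) powr \<alpha>))
        = M * (?c * h + h powr (1 - \<alpha>) / (1 - \<alpha>))"
    by (rule has_integral_integrable, rule integral_unique)
  have "norm (integral {x - h..x} (\<lambda>t. g t * (?c - 1 / (x - t) powr \<alpha>)))
      \<le> M * (?c * h + h powr (1 - \<alpha>) / (1 - \<alpha>))"
    unfolding majorant_eq[symmetric]
  proof (rule integral_norm_bound_integral[OF _ majorant])
    show "(\<lambda>t. g t * (?c - 1 / (x - t) powr \<alpha>)) integrable_on {x - h..x}"
      using integrable_diff[OF integrable_on_mult_left[OF integrable_continuous_real[OF g], of ?c] int]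
      by (simp add: algebra_simps)
    show "norm (g t * (?c - 1 / (x - t) powr \<alpha>)) \<le> M * (?c + 1 / (x - t) powr \<alpha>)"
      if "t \<in> {x - h..x}" for t
    proof -
      have "\<bar>?c - 1 / (x - t) powr \<alpha>\<bar> \<le> ?c + 1 / (x - t) powr \<alpha>"
        using c by (simp add: abs_le_iff)
      then show ?thesis
        using M[OF that] by (simp add: abs_mult mult_mono')
    qed
  qed
  also have "M * (?c * h + h powr (1 - \<alpha>) / (1 - \<alpha>))
      = M * h powr (1 - \<alpha>) * (\<alpha> * zeta (1 + \<alpha>) + 1 / (1 - \<alpha>))"
    using assms by (simp add: powr_diff algebra_simps)
  finally show ?thesis
    by simp
qed

text \<open>
  The block errors are \<open>M * h powr (1 - \<alpha>)\<close> times numbers \<open>e k\<close> that do not depend on \<open>h\<close> and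
  telescope from \<open>k = 1\<close> on. Hence their sum is bounded uniformly in \<open>n\<close>; this is where it
  matters that the block bounds are differences, since the bound
  \<open>k powr - \<alpha>\<close> for each of them would only give a total error of order \<open>1\<close>.
\<close>
lemma quadrature_error:
  fixes g y :: "real \<Rightarrow> real"
  assumes "0 < \<alpha>" "\<alpha> < 1" "0 < x" "0 < n"
    and deriv: "\<And>t. t \<in> {0..x} \<Longrightarrow> (y has_real_derivative g t) (at t within {0..x})"
    and g: "continuous_on {0..x} g"
    and M: "\<And>t. t \<in> {0..x} \<Longrightarrow> \<bar>g t\<bar> \<le> M"
    and h: "h = x / real n"
  shows "\<bar>\<alpha> / h powr \<alpha> * (\<Sum>k<n. zeta_tail \<alpha> k * (y (x - real k * h) - y (x - real (Suc k) * h)))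
          - integral {0..x} (\<lambda>t. g t / (x - t) powr \<alpha>)\<bar>
         \<le> M * (\<alpha> * zeta (1 + \<alpha>) + 1 / (1 - \<alpha>) + 1) * h powr (1 - \<alpha>)"
proof -
  define B where "B k = {x - real (Suc k) * h..x - real k * h}" for k
  define c where "c k = \<alpha> * zeta_tail \<alpha> k / h powr \<alpha>" for k
  define e where "e k = (if k = 0 then \<alpha> * zeta (1 + \<alpha>) + 1 / (1 - \<alpha>)
                         else real k powr - \<alpha> - real (Suc k) powr - \<alpha>)" for k
  have h0: "0 < h" and nh: "real n * h = x"
    using assms by (auto simp: h)
  have M0: "0 \<le> M"
    using M[of x] \<open>0 < x\<close> by force
  have int: "(\<lambda>t. g t / (x - t) powr \<alpha>) integrable_on {0..x}"
    using caputo_integrand_absolutely_integrable[OF assms(1,2) _ g] assms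
    by (auto dest: set_lebesgue_integral_eq_integral(1))
  have B_sub: "B k \<subseteq> {0..x}" if "k < n" for k
  proof -
    have "real (Suc k) * h \<le> real n * h"
      using that h0 by (intro mult_right_mono) auto
    then show ?thesis
      using h0 nh by (auto simp: B_def)
  qed
  have B_le: "x - real (Suc k) * h \<le> x - real k * h" for k
    using h0 by (auto simp: algebra_simps)
  have gB: "continuous_on (B k) g" if "k < n" for k
    using g B_sub[OF that] by (rule continuous_on_subset)
  have intB: "(\<lambda>t. g t / (x - t) powr \<alpha>) integrable_on B k" if "k < n" for k
    using integrable_subinterval_real[OF int, of "x - real (Suc k) * h" "x - real k * h"] B_sub[OF that]
    by (simp add: B_def)
  have block: "c k * (y (x - real k * h) - y (x - real (Suc k) * h))
        - integral (B k) (\<lambda>t. g t / (x - t) powr \<alpha>)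
      = integral (B k) (\<lambda>t. g t * (c k - 1 / (x - t) powr \<alpha>))" if "k < n" for k
  proof -
    have "(g has_integral y (x - real k * h) - y (x - real (Suc k) * h)) (B k)"
      unfolding B_def
    proof (rule fundamental_theorem_of_calculus[OF B_le])
      fix t assume "t \<in> {x - real (Suc k) * h..x - real k * h}"
      then show "(y has_vector_derivative g t) (at t within {x - real (Suc k) * h..x - real k * h})"
        using B_sub[OF that] deriv[of t] unfolding B_def
        by (auto simp: has_real_derivative_iff_has_vector_derivative
                 intro: has_vector_derivative_within_subset)
    qed
    from has_integral_diff[OF has_integral_mult_right[OF this, of "c k"]
        integrable_integral[OF intB[OF that]]]
    show ?thesis
      by (intro integral_unique[symmetric]) (simp add: algebra_simps)
  qed
  have error: "\<bar>integral (B k) (\<lambda>t. g t * (c k - 1 / (x - t) powr \<alpha>))\<bar> \<le> M * h powr (1 - \<alpha>) * e k"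
    if "k < n" for k
  proof (cases "k = 0")
    case True
    then show ?thesis
      using block_error_singular[of \<alpha> h g x M] assms(1,2) h0 M B_sub[OF that] gB[OF that] intB[OF that]
      by (auto simp: B_def c_def e_def)
  next
    case False
    moreover have "\<bar>g t\<bar> \<le> M" if "t \<in> B k" for t
      using M B_sub[OF \<open>k < n\<close>] that by blast
    ultimately show ?thesis
      using block_error_regular[of \<alpha> h k x g M] assms(1) h0 gB[OF that]
      unfolding B_def c_def e_def by simp
  qed
  have e_sum: "(\<Sum>k<n. e k) \<le> \<alpha> * zeta (1 + \<alpha>) + 1 / (1 - \<alpha>) + 1"
  proof -
    obtain m where m: "n = Suc m"
      using \<open>0 < n\<close> not0_implies_Suc by blast
    have "(\<Sum>k<n. e k) = e 0 + (\<Sum>k<m. real (Suc k) powr - \<alpha> - real (Suc (Suc k)) powr - \<alpha>)"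
      unfolding m by (subst sum.lessThan_Suc_shift) (simp add: e_def)
    also have "(\<Sum>k<m. real (Suc k) powr - \<alpha> - real (Suc (Suc k)) powr - \<alpha>)
        = 1 - real (Suc m) powr - \<alpha>"
      using sum_lessThan_telescope'[of "\<lambda>k. real (Suc k) powr - \<alpha>" m] by simp
    finally show ?thesis
      by (simp add: e_def)
  qed
  have "\<alpha> / h powr \<alpha> * (\<Sum>k<n. zeta_tail \<alpha> k * (y (x - real k * h) - y (x - real (Suc k) * h)))
          - integral {0..x} (\<lambda>t. g t / (x - t) powr \<alpha>)
      = (\<Sum>k<n. c k * (y (x - real k * h) - y (x - real (Suc k) * h)))
          - (\<Sum>k<n. integral (B k) (\<lambda>t. g t / (x - t) powr \<alpha>))"
    using sum_integral_backward_blocks[of h "\<lambda>t. g t / (x - t) powr \<alpha>" x n] h0 int nh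
    by (simp add: B_def c_def sum_distrib_left mult.assoc)
  also have "\<dots> = (\<Sum>k<n. integral (B k) (\<lambda>t. g t * (c k - 1 / (x - t) powr \<alpha>)))"
    unfolding sum_subtractf[symmetric] by (rule sum.cong[OF refl block]) simp
  also have "\<bar>\<dots>\<bar> \<le> (\<Sum>k<n. M * h powr (1 - \<alpha>) * e k)"
    by (intro order_trans[OF sum_abs] sum_mono error) auto
  also have "\<dots> = M * h powr (1 - \<alpha>) * (\<Sum>k<n. e k)"
    by (simp add: sum_distrib_left)
  also have "\<dots> \<le> M * h powr (1 - \<alpha>) * (\<alpha> * zeta (1 + \<alpha>) + 1 / (1 - \<alpha>) + 1)"
    using M0 by (intro mult_left_mono e_sum) auto
  finally show ?thesis
    by (simp add: mult_ac)
qed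

section \<open>The approximation of the Caputo derivative\<close>

lemma smooth_on_set_C1:
  assumes "smooth_on_set S f"
  obtains g where "\<And>t. t \<in> S \<Longrightarrow> (f has_real_derivative g t) (at t within S)" and "continuous_on S g"
proof -
  obtain D where D0: "\<And>t. t \<in> S \<Longrightarrow> D 0 t = f t"
      and D: "\<And>k t. t \<in> S \<Longrightarrow> (D k has_real_derivative D (Suc k) t) (at t within S)"
    using assms unfolding smooth_on_set_def by blast
  have "(f has_real_derivative D 1 t) (at t within S)" if "t \<in> S" for t
    using has_field_derivative_transform_within[OF D[OF that, of 0] zero_less_one that] D0 by simp
  moreover have "continuous_on S (D 1)"
    using D DERIV_continuous_on by blast
  ultimately show thesis
    using that by blast
qed

lemma caputo_eq_integral:
  assumes "0 < x"
    and "\<And>t. t \<in> {0..x} \<Longrightarrow> (y has_real_derivative g t) (at t within {0..x})"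
  shows "caputo \<alpha> y x = 1 / Gamma (1 - \<alpha>) * integral {0..x} (\<lambda>t. g t / (x - t) powr \<alpha>)"
proof -
  have "vector_derivative y (at t within {0..x}) = g t" if "t \<in> {0..x}" for t
    using assms that
    by (intro vector_derivative_within_closed_interval)
       (simp_all add: has_real_derivative_iff_has_vector_derivative)
  then have "integral {0..x} (\<lambda>t. vector_derivative y (at t within {0..x}) / (x - t) powr \<alpha>)
      = integral {0..x} (\<lambda>t. g t / (x - t) powr \<alpha>)"
    by (intro integral_cong) simp
  then show ?thesis
    by (simp add: caputo_def)
qed

lemma Gamma_one_minus:
  fixes \<alpha> :: real
  assumes "0 < \<alpha>" "\<alpha> < 1"
  shows "Gamma (1 - \<alpha>) = - \<alpha> * Gamma (- \<alpha>)"
proof -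
  have "- \<alpha> \<notin> \<int>\<^sub>\<le>\<^sub>0"
  proof
    assume "- \<alpha> \<in> \<int>\<^sub>\<le>\<^sub>0"
    then obtain i where "- \<alpha> = of_int i"
      by (auto elim: nonpos_Ints_cases)
    with assms have "- 1 < i" "i < 0"
      by linarith+
    then show False
      by simp
  qed
  from Gamma_plus1[OF this] show ?thesis
    by simp
qed

theorem corollary12:
  fixes \<alpha> x :: real and y :: "real \<Rightarrow> real"
  assumes "0 < \<alpha>" and "\<alpha> < 1" and "0 < x"
    and "smooth_on_set {0..x} y"
  shows "(\<lambda>n::nat. let h = x / real n in
            1 / (Gamma (- \<alpha>) * h powr \<alpha>) *
              (\<Sum>k = 0..n. weight \<alpha> n k * y (real (n - k) * h))
            - caputo \<alpha> y x)
         \<in> O[at_top](\<lambda>n. let h = x / real n in h powr (1 - \<alpha>))"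
proof -
  obtain g where deriv: "\<And>t. t \<in> {0..x} \<Longrightarrow> (y has_real_derivative g t) (at t within {0..x})"
      and g: "continuous_on {0..x} g"
    using smooth_on_set_C1[OF assms(4)] by blast
  have "bounded (g ` {0..x})"
    using g by (intro compact_imp_bounded compact_continuous_image) auto
  then obtain M where M: "\<And>t. t \<in> {0..x} \<Longrightarrow> \<bar>g t\<bar> \<le> M"
    unfolding bounded_iff real_norm_def by blast
  define I where "I = integral {0..x} (\<lambda>t. g t / (x - t) powr \<alpha>)"
  define C where "C = M * (\<alpha> * zeta (1 + \<alpha>) + 1 / (1 - \<alpha>) + 1)"
  have G: "0 < Gamma (1 - \<alpha>)"
    using assms by simp
  have bound: "\<bar>1 / (Gamma (- \<alpha>) * h powr \<alpha>) * (\<Sum>k = 0..n. weight \<alpha> n k * y (real (n - k) * h))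
      - caputo \<alpha> y x\<bar> \<le> C / Gamma (1 - \<alpha>) * h powr (1 - \<alpha>)"
    if n: "0 < n" and h: "h = x / real n" for n h
  proof -
    let ?S = "\<Sum>k<n. zeta_tail \<alpha> k * (y (x - real k * h) - y (x - real (Suc k) * h))"
    have "(\<Sum>k = 0..n. weight \<alpha> n k * y (real (n - k) * h)) = (\<Sum>k = 0..n. weight \<alpha> n k * y (x - real k * h))"
      using n by (intro sum.cong) (auto simp: h of_nat_diff algebra_simps diff_divide_distrib)
    also have "\<dots> = (\<Sum>k<n. zeta_tail \<alpha> k * (y (x - real (Suc k) * h) - y (x - real k * h)))"
      by (rule sum_weight_by_parts[OF n])
    also have "\<dots> = - ?S"
      by (simp add: sum_negf[symmetric] algebra_simps)
    finally have "1 / (Gamma (- \<alpha>) * h powr \<alpha>) * (\<Sum>k = 0..n. weight \<alpha> n k * y (real (n - k) * h))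
        - caputo \<alpha> y x = (\<alpha> / h powr \<alpha> * ?S - I) / Gamma (1 - \<alpha>)"
      using caputo_eq_integral[OF \<open>0 < x\<close> deriv] Gamma_one_minus[OF assms(1,2)] G assms(1)
      by (simp add: I_def diff_divide_distrib)
    moreover have "\<bar>\<alpha> / h powr \<alpha> * ?S - I\<bar> \<le> C * h powr (1 - \<alpha>)"
      unfolding I_def C_def by (rule quadrature_error[OF assms(1-3) n deriv g M h])
    ultimately show ?thesis
      using G by (simp add: divide_right_mono)
  qed
  show ?thesis
  proof (rule bigoI)
    show "\<forall>\<^sub>F n in at_top.
        norm (let h = x / real n in
            1 / (Gamma (- \<alpha>) * h powr \<alpha>) *
              (\<Sum>k = 0..n. weight \<alpha> n k * y (real (n - k) * h)) - caputo \<alpha> y x)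
        \<le> C / Gamma (1 - \<alpha>) * norm (let h = x / real n in h powr (1 - \<alpha>))"
      using eventually_gt_at_top[of 0] by eventually_elim (use bound in \<open>simp add: Let_def\<close>)
  qed
qed

end
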